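(* Let $s\ge 1$ be an integer, let $A\in\mathbb{R}^{s\times s}$ be a lower triangular matrix (diagonal entries allowed to be nonzero), let $b\in\mathbb{R}^s$, and let $e=(1,1,\ldots,1)^T\in\mathbb{R}^s$. Suppose that $$b^Te=1,\qquad b^TAe=\tfrac12,$$ and that $r>0$ is a real number such that $I+rA$ is invertible and, entrywise, $$(I+rA)^{-1}e\ge 0,\qquad rA(I+rA)^{-1}\ge 0,\qquad b^T(I+rA)^{-1}\ge 0,\qquad 1-r\,b^T(I+rA)^{-1}e\ge 0.$$ Then $r\le 2s$.
   Context: The pair $(A,b)$ are the Butcher coefficients of an $s$-stage Runge--Kutta method; the method is called diagonally implicit (DIRK) when $A$ is lower triangular. The two equalities are the conditions for order at least two. The largest $r$ satisfying the invertibility condition and the four inequalities is called the SSP coefficient (radius of absolute monotonicity) of the method. $I$ is the $s\times s$ identity matrix; inequalities between vectors or matrices are entrywise. *)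

theory Defs
  imports Complex_Main "Jordan_Normal_Form.Gauss_Jordan_Elimination"
begin

definition lower_triangular :: "'a::zero mat \<Rightarrow> bool" where
  "lower_triangular A \<longleftrightarrow> (\<forall>i < dim_row A. \<forall>j < dim_col A. i < j \<longrightarrow> A $$ (i,j) = 0)"

definition ones_vec :: "nat \<Rightarrow> real vec" where
  "ones_vec s = vec s (\<lambda>_. 1)"

text \<open>Total inverse function; unspecified when the matrix is not invertible, see
  \<open>mat_inv_inverse\<close> below.\<close>

definition mat_inv :: "'a::field mat \<Rightarrow> 'a mat" where
  "mat_inv M = the (mat_inverse M)"

lemma mat_inv_inverse:
  fixes M :: "'a::field mat"
  assumes M: "M \<in> carrier_mat n n" and inv: "invertible_mat M"
  shows "mat_inv M \<in> carrier_mat n n"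
    and "M * mat_inv M = 1\<^sub>m n"
    and "mat_inv M * M = 1\<^sub>m n"
proof -
  from inv obtain B where B: "M * B = 1\<^sub>m (dim_row M)" "B * M = 1\<^sub>m (dim_row B)"
    by (auto simp: invertible_mat_def inverts_mat_def)
  from arg_cong[OF B(1), of dim_col] arg_cong[OF B(2), of dim_col] M
  have "B \<in> carrier_mat n n" by auto
  with B M have "M \<in> Units (ring_mat TYPE('a) n ())"
    by (auto simp: Units_def ring_mat_simps intro!: bexI[of _ B])
  then obtain C where C: "mat_inverse M = Some C"
    using mat_inverse(1)[OF M, where b = "()"] by (cases "mat_inverse M") auto
  from mat_inverse(2)[OF M C] C
  show "mat_inv M \<in> carrier_mat n n" "M * mat_inv M = 1\<^sub>m n" "mat_inv M * M = 1\<^sub>m n"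
    by (auto simp: mat_inv_def)
qed

end

theory Submission
  imports Defs "HOL-Analysis.Convex" "Jordan_Normal_Form.Determinant"
begin

unbundle no inner_syntax

text \<open>
  With \<open>K = (I + rA)\<^sup>-\<^sup>1\<close> and \<open>B = rAK = I - K\<close>, the hypotheses say that \<open>B\<close> is a lower triangular
  substochastic matrix and that \<open>r b\<^sup>TK\<close> is a subprobability vector. They are the jump matrix and
  the initial distribution of a Markov chain with \<open>s\<close> states that never moves upwards. If each visit
  to a state lasts an independent unit exponential time, then the time \<open>T\<close> to absorption
  has \<open>E T = r b\<^sup>Te = r\<close> and \<open>E T\<^sup>2 = 2r b\<^sup>T(I + rA)e = r\<^sup>2 + 2r\<close> by the order conditions.
  As in the theorem of Aldous and Shepp on phase-type distributions,
  \<open>s E T\<^sup>2 \<ge> (s + 1) (E T)\<^sup>2\<close>, which is \<open>r \<le> 2s\<close>.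
\<close>

section \<open>Moments of absorption times\<close>

lemma weighted_Cauchy_Schwarz:
  fixes w x :: "'a \<Rightarrow> real"
  assumes "\<And>i. i \<in> I \<Longrightarrow> 0 \<le> w i"
  shows "(\<Sum>i\<in>I. w i * x i)\<^sup>2 \<le> (\<Sum>i\<in>I. w i) * (\<Sum>i\<in>I. w i * (x i)\<^sup>2)"
proof -
  have "(\<Sum>i\<in>I. sqrt (w i) * (sqrt (w i) * x i))\<^sup>2
      \<le> (\<Sum>i\<in>I. (sqrt (w i))\<^sup>2) * (\<Sum>i\<in>I. (sqrt (w i) * x i)\<^sup>2)"
    by (rule Cauchy_Schwarz_ineq_sum)
  moreover have "(\<Sum>i\<in>I. sqrt (w i) * (sqrt (w i) * x i)) = (\<Sum>i\<in>I. w i * x i)"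
    using assms by (intro sum.cong) (simp_all flip: mult.assoc)
  ultimately show ?thesis
    using assms by (simp add: power_mult_distrib cong: sum.cong)
qed

text \<open>Here \<open>x i\<close> and \<open>2 * z i\<close> are the first two moments of the absorption time from state \<open>i\<close>,
  obtained by conditioning on the first step; \<open>i + 1\<close> states can be visited from \<open>i\<close>.\<close>

lemma acyclic_phase_type_moments:
  fixes B :: "nat \<Rightarrow> nat \<Rightarrow> real" and x z :: "nat \<Rightarrow> real"
  assumes nonneg: "\<And>i j. i < n \<Longrightarrow> j < i \<Longrightarrow> 0 \<le> B i j"
    and diag: "\<And>i. i < n \<Longrightarrow> B i i < 1"
    and row: "\<And>i. i < n \<Longrightarrow> (\<Sum>j\<le>i. B i j) \<le> 1"
    and x: "\<And>i. i < n \<Longrightarrow> x i = 1 + (\<Sum>j\<le>i. B i j * x j)"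
    and z: "\<And>i. i < n \<Longrightarrow> z i = x i + (\<Sum>j\<le>i. B i j * z j)"
    and "i < n"
  shows "(real i + 2) * (x i)\<^sup>2 \<le> 2 * (real i + 1) * z i"
  using \<open>i < n\<close>
proof (induction i rule: less_induct)
  case (less i)
  \<comment> \<open>Moving the self-loop term to the left leaves \<open>q\<close>, the probability
    of leaving \<open>i\<close>, as a factor. The remaining sums involve only states below
    \<open>i\<close>.\<close>
  define q where "q = 1 - B i i"
  define S\<^sub>1 where "S\<^sub>1 = (\<Sum>j<i. B i j * x j)"
  define S\<^sub>2 where "S\<^sub>2 = (\<Sum>j<i. B i j * z j)"
  define Q where "Q = (\<Sum>j<i. B i j * (x j)\<^sup>2)"
  note simps = lessThan_Suc_atMost[symmetric]
  have q: "q > 0" using diag less.prems by (simp add: q_def)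
  have qx: "q * x i = 1 + S\<^sub>1"
    using x[OF less.prems] by (simp add: q_def S\<^sub>1_def simps algebra_simps)
  have qz: "q * z i = x i + S\<^sub>2"
    using z[OF less.prems] by (simp add: q_def S\<^sub>2_def simps algebra_simps)
  have "0 \<le> Q"
    unfolding Q_def using nonneg less.prems by (intro sum_nonneg) simp
  have "S\<^sub>1\<^sup>2 \<le> (\<Sum>j<i. B i j) * Q"
    unfolding S\<^sub>1_def Q_def using nonneg less.prems by (intro weighted_Cauchy_Schwarz) auto
  also have "\<dots> \<le> q * Q"
    using row[OF less.prems] \<open>0 \<le> Q\<close> by (intro mult_right_mono) (auto simp: q_def simps)
  finally have S1: "S\<^sub>1\<^sup>2 \<le> q * Q" .
  \<comment> \<open>The ratio (j + 2) / (j + 1) decreases in j, so the induction hypothesis at any j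
    < i yields the bound in the form it has at j = i - 1, with constants independent of j.\<close>
  have "(real i + 1) * (x j)\<^sup>2 \<le> 2 * real i * z j" if "j < i" for j
  proof -
    have IH: "(real j + 2) * (x j)\<^sup>2 \<le> 2 * (real j + 1) * z j"
      using less that by simp
    have "(real i + 1) * (real j + 1) \<le> (real j + 2) * real i"
      using that by (simp add: algebra_simps)
    then have "(real i + 1) * (real j + 1) * (x j)\<^sup>2 \<le> (real j + 2) * real i * (x j)\<^sup>2"
      by (rule mult_right_mono) simp
    also have "\<dots> \<le> real i * (2 * (real j + 1) * z j)"
      using mult_left_mono[OF IH, of "real i"] by (simp add: mult_ac)
    finally have "(real j + 1) * ((real i + 1) * (x j)\<^sup>2) \<le> (real j + 1) * (2 * real i * z j)"
      by (simp add: mult_ac)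
    then show ?thesis
      by (rule mult_left_le_imp_le) simp
  qed
  then have "(\<Sum>j<i. B i j * ((real i + 1) * (x j)\<^sup>2)) \<le> (\<Sum>j<i. B i j * (2 * real i * z j))"
    using nonneg less.prems by (intro sum_mono mult_left_mono) auto
  then have "(real i + 1) * Q \<le> 2 * real i * S\<^sub>2"
    by (simp add: Q_def S\<^sub>2_def sum_distrib_left mult_ac)
  then have "q * ((real i + 1) * Q) \<le> q * (2 * real i * S\<^sub>2)"
    using q by (intro mult_left_mono) auto
  moreover have "(real i + 1) * S\<^sub>1\<^sup>2 \<le> (real i + 1) * (q * Q)"
    using S1 by (intro mult_left_mono) auto
  ultimately have S2: "(real i + 1) * S\<^sub>1\<^sup>2 \<le> 2 * real i * (q * S\<^sub>2)"
    by (simp only: mult_ac)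
  define y where "y = q * x i"
  have S1y: "S\<^sub>1 = y - 1" using qx by (simp add: y_def)
  have qqz: "q\<^sup>2 * z i = y + q * S\<^sub>2"
    using arg_cong[OF qz, of "\<lambda>t. q * t"] by (simp add: power2_eq_square y_def algebra_simps)
  \<comment> \<open>This is the goal multiplied by \<open>q\<^sup>2\<close>.\<close>
  have "(real i + 2) * y\<^sup>2 \<le> 2 * (real i + 1) * (y + q * S\<^sub>2)"
  proof (cases "i = 0")
    case True
    then show ?thesis using S1y by (simp add: S\<^sub>1_def S\<^sub>2_def)
  next
    case False
    \<comment> \<open>The added square is exactly the slack. It vanishes at y = i + 1, as for the
      chain that visits i, i - 1, ..., 0 once each.\<close>
    have "real i * ((real i + 2) * y\<^sup>2) \<le> real i * ((real i + 2) * y\<^sup>2) + (y - (real i + 1))\<^sup>2"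
      by simp
    also have "\<dots> = real i * (2 * (real i + 1) * y) + (real i + 1) * ((real i + 1) * S\<^sub>1\<^sup>2)"
      by (simp add: S1y power2_eq_square algebra_simps)
    also have "\<dots> \<le> real i * (2 * (real i + 1) * y) + (real i + 1) * (2 * real i * (q * S\<^sub>2))"
      using S2 by (intro add_left_mono mult_left_mono) auto
    also have "\<dots> = real i * (2 * (real i + 1) * (y + q * S\<^sub>2))"
      by (simp add: algebra_simps)
    finally show ?thesis
      by (rule mult_left_le_imp_le) (use False in simp)
  qed
  then have "(real i + 2) * (q * x i)\<^sup>2 \<le> 2 * (real i + 1) * (q\<^sup>2 * z i)"
    by (simp only: qqz y_def)
  then have "q\<^sup>2 * ((real i + 2) * (x i)\<^sup>2) \<le> q\<^sup>2 * (2 * (real i + 1) * z i)"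
    by (simp only: power_mult_distrib mult_ac)
  then show ?case
    by (rule mult_left_le_imp_le) (use q in simp)
qed

section \<open>Triangular matrices\<close>

lemma lower_triangular_diag_nonzero:
  fixes L :: "'a::field mat"
  assumes L: "L \<in> carrier_mat n n" and tri: "lower_triangular L" and inv: "invertible_mat L"
    and "i < n"
  shows "L $$ (i,i) \<noteq> 0"
proof -
  note K = mat_inv_inverse[OF L inv]
  have "det L * det (mat_inv L) = 1"
    using det_mult[OF L K(1)] K(2) by simp
  moreover have "det L = prod_list (diag_mat L)"
    using tri L by (intro det_lower_triangular[of n]) (auto simp: lower_triangular_def)
  ultimately have "prod_list (diag_mat L) \<noteq> 0"
    by (metis mult_zero_left zero_neq_one)
  then show ?thesis
    using L \<open>i < n\<close> by (auto simp: prod_list_zero_iff diag_mat_def)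
qed

text \<open>Go through the columns from the last to the first: for i < j, once row i of
  \<open>B\<close> is known to vanish right of column j, entry (i,j) of \<open>B * L\<close> is just
  \<open>B $$ (i,j) * L $$ (j,j)\<close>. The products \<open>B * L = r \<cdot>\<^sub>m A\<close>
  and \<open>K * L = 1\<^sub>m s\<close> will make \<open>B\<close> and \<open>K\<close>
  triangular.\<close>

lemma lower_triangular_mult_cancel:
  fixes B L :: "'a::field mat"
  assumes B: "B \<in> carrier_mat n n" and L: "L \<in> carrier_mat n n"
    and tri: "lower_triangular L" and diag: "\<And>i. i < n \<Longrightarrow> L $$ (i,i) \<noteq> 0"
    and BL: "lower_triangular (B * L)"
  shows "lower_triangular B"
proof -
  have "B $$ (i,j) = 0" if "i < j" "j < n" for i j
    using that
  proof (induction "n - j" arbitrary: j rule: less_induct)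
    case less
    have "0 = (B * L) $$ (i,j)"
      using BL less.prems B L by (auto simp: lower_triangular_def)
    also have "\<dots> = (\<Sum>k<n. B $$ (i,k) * L $$ (k,j))"
      using B L less.prems by (simp add: scalar_prod_def lessThan_atLeast0)
    also have "\<dots> = (\<Sum>k\<in>{j}. B $$ (i,k) * L $$ (k,j))"
    proof (rule sum.mono_neutral_right)
      show "\<forall>k\<in>{..<n} - {j}. B $$ (i,k) * L $$ (k,j) = 0"
      proof
        fix k assume k: "k \<in> {..<n} - {j}"
        show "B $$ (i,k) * L $$ (k,j) = 0"
        proof (cases "k < j")
          case True
          then show ?thesis using tri L less.prems by (auto simp: lower_triangular_def)
        next
          case False
          then show ?thesis using less.hyps[of k] less.prems k by auto
        qed
      qed
    qed (use less.prems in auto)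
    finally show ?case using diag[OF less.prems(2)] by simp
  qed
  then show ?thesis using B by (auto simp: lower_triangular_def)
qed

section \<open>From Butcher coefficients to the Markov chain\<close>

theorem theorem2p6:
  fixes s :: nat and A :: "real mat" and b :: "real vec" and r :: real
  assumes "s \<ge> 1"
    and "A \<in> carrier_mat s s" and "lower_triangular A"
    and "b \<in> carrier_vec s"
    and "b \<bullet> ones_vec s = 1"
    and "b \<bullet> (A *\<^sub>v ones_vec s) = 1 / 2"
    and "r > 0"
    and "invertible_mat (1\<^sub>m s + r \<cdot>\<^sub>m A)"
    and "mat_inv (1\<^sub>m s + r \<cdot>\<^sub>m A) *\<^sub>v ones_vec s \<ge> 0\<^sub>v s"
    and "(r \<cdot>\<^sub>m A) * mat_inv (1\<^sub>m s + r \<cdot>\<^sub>m A) \<ge> 0\<^sub>m s s"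
    and "transpose_mat (mat_inv (1\<^sub>m s + r \<cdot>\<^sub>m A)) *\<^sub>v b \<ge> 0\<^sub>v s"
    and "1 - r * (b \<bullet> (mat_inv (1\<^sub>m s + r \<cdot>\<^sub>m A) *\<^sub>v ones_vec s)) \<ge> 0"
  shows "r \<le> 2 * real s"
proof -
  define L where "L = 1\<^sub>m s + r \<cdot>\<^sub>m A"
  define K where "K = mat_inv L"
  define B where "B = (r \<cdot>\<^sub>m A) * K"
  define e where "e = ones_vec s"
  \<comment> \<open>Since \<open>K\<close> = I - \<open>B\<close> is the inverse of
    \<open>L\<close>, the moment equations x = e + Bx and z = x + Bz read Kx = e and Kz = x, and are
    solved by applying \<open>L\<close>.\<close>
  define x where "x = L *\<^sub>v e"
  define z where "z = L *\<^sub>v x"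
  \<comment> \<open>The initial distribution is \<open>r\<close> times \<open>w\<close>.\<close>
  define w where "w = transpose_mat K *\<^sub>v b"
  note [simp] = assms(2,4)
  have L[simp]: "L \<in> carrier_mat s s" by (simp add: L_def)
  note inv = mat_inv_inverse[OF L assms(8)[folded L_def], folded K_def]
  note [simp] = inv(1)
  have carr[simp]: "B \<in> carrier_mat s s" "e \<in> carrier_vec s" "x \<in> carrier_vec s"
      "z \<in> carrier_vec s" "w \<in> carrier_vec s"
    unfolding B_def e_def ones_vec_def x_def z_def w_def
    by (auto intro!: mult_carrier_mat[of _ s s] mult_mat_vec_carrier[of _ s s])
  note [simp] = carrier_matD[OF assms(2)] carrier_matD[OF L] carrier_matD[OF inv(1)]
    carrier_matD[OF carr(1)]
  have e_nth: "e $ i = 1" if "i < s" for i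
    using that by (simp add: e_def ones_vec_def)
  have KLv: "K *\<^sub>v (L *\<^sub>v v) = v" if "v \<in> carrier_vec s" for v
    using assoc_mult_mat_vec[OF inv(1) L that] that by (simp add: inv(3))
  have Kx: "K *\<^sub>v x = e" and Kz: "K *\<^sub>v z = x"
    using KLv[of e] KLv[of x] by (simp_all flip: x_def z_def)
  have "L * K = K + B"
    using add_mult_distrib_mat[of "1\<^sub>m s" s s "r \<cdot>\<^sub>m A" K s]
    by (simp add: L_def B_def left_mult_one_mat[OF inv(1)])
  then have BK: "B + K = 1\<^sub>m s"
    using comm_add_mat[of B s s K] by (simp add: inv(2))
  have BKv: "(B *\<^sub>v v) $ i + (K *\<^sub>v v) $ i = v $ i" if "v \<in> carrier_vec s" "i < s" for v i
  proof -
    have "(B + K) *\<^sub>v v = B *\<^sub>v v + K *\<^sub>v v"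
      by (rule add_mult_distrib_mat_vec[OF carr(1) inv(1) that(1)])
    then have "B *\<^sub>v v + K *\<^sub>v v = v" using that by (simp add: BK)
    from arg_cong[OF this, of "\<lambda>u. u $ i"] show ?thesis using that by simp
  qed
  have triL: "lower_triangular L"
    using assms(2,3) by (auto simp: lower_triangular_def L_def)
  have diagL: "L $$ (i,i) \<noteq> 0" if "i < s" for i
    using lower_triangular_diag_nonzero[OF L triL] assms(8) that by (simp add: L_def)
  have "B * L = r \<cdot>\<^sub>m A"
    by (simp add: B_def inv(3) assoc_mult_mat[of _ s s _ s _ s])
  then have triB: "lower_triangular B"
    using assms(3) lower_triangular_mult_cancel[OF carr(1) L triL diagL]
    by (auto simp: lower_triangular_def)
  have triK: "lower_triangular K"
    by (rule lower_triangular_mult_cancel[OF inv(1) L triL diagL])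
      (auto simp: lower_triangular_def inv(3))
  have B_nonneg: "B $$ (i,j) \<ge> 0" if "i < s" "j < s" for i j
    using assms(10)[folded L_def, folded K_def, folded B_def] that by (simp add: less_eq_mat_def)
  have Bv: "(B *\<^sub>v v) $ i = (\<Sum>j\<le>i. B $$ (i,j) * v $ j)" if "v \<in> carrier_vec s" "i < s" for v i
  proof -
    have "(B *\<^sub>v v) $ i = (\<Sum>j<s. B $$ (i,j) * v $ j)"
      using that by (simp add: scalar_prod_def lessThan_atLeast0)
    also have "\<dots> = (\<Sum>j\<le>i. B $$ (i,j) * v $ j)"
      using that triB by (intro sum.mono_neutral_right) (auto simp: lower_triangular_def)
    finally show ?thesis .
  qed
  have row: "(\<Sum>j\<le>i. B $$ (i,j)) \<le> 1" if "i < s" for i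
  proof -
    \<comment> \<open>Be = e - Ke, so nonnegativity of Ke bounds the row sums of
      \<open>B\<close>.\<close>
    have "(K *\<^sub>v e) $ i \<ge> 0"
      using assms(9)[folded L_def, folded K_def, folded e_def] that
      by (simp add: less_eq_vec_def del: index_mult_mat_vec)
    then show ?thesis
      using BKv[of e i] Bv[of e i] that by (simp add: e_nth)
  qed
  \<comment> \<open>The row sums only give a bound of 1. Equality would mean a zero on the diagonal
    of \<open>K\<close>, but triangularity gives \<open>K $$ (i,i) * L $$ (i,i) = 1\<close>.\<close>
  have diag: "B $$ (i,i) < 1" if "i < s" for i
  proof -
    have "(K * L) $$ (i,i) = (\<Sum>k<s. K $$ (i,k) * L $$ (k,i))"
      using that by (simp add: scalar_prod_def lessThan_atLeast0)
    also have "\<dots> = (\<Sum>k\<in>{i}. K $$ (i,k) * L $$ (k,i))"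
      using that triK triL by (intro sum.mono_neutral_right) (auto simp: lower_triangular_def nat_neq_iff)
    finally have "K $$ (i,i) \<noteq> 0" using that by (auto simp: inv(3))
    moreover have "B $$ (i,i) + K $$ (i,i) = 1"
      using arg_cong[OF BK, of "\<lambda>M. M $$ (i,i)"] that by simp
    moreover have "B $$ (i,i) \<le> (\<Sum>j\<le>i. B $$ (i,j))"
      using B_nonneg that by (intro member_le_sum) auto
    ultimately show ?thesis using row[OF that] by linarith
  qed
  \<comment> \<open>As i + 1 is at most \<open>s\<close>, the same monotonicity gives one constant
    for all initial states.\<close>
  have moments: "(real s + 1) * (x $ i)\<^sup>2 \<le> 2 * real s * z $ i" if i: "i < s" for i
  proof -
    have *: "(real i + 2) * (x $ i)\<^sup>2 \<le> 2 * (real i + 1) * z $ i"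
    proof (rule acyclic_phase_type_moments[where n = s and B = "\<lambda>i j. B $$ (i,j)"])
      fix i assume i: "i < s"
      show "x $ i = 1 + (\<Sum>j\<le>i. B $$ (i,j) * x $ j)"
        using BKv[of x i] Bv[of x i] i by (simp add: Kx e_nth)
      show "z $ i = x $ i + (\<Sum>j\<le>i. B $$ (i,j) * z $ j)"
        using BKv[of z i] Bv[of z i] i by (simp add: Kz)
    qed (use B_nonneg diag row i in auto)
    have "(real s + 1) * (real i + 1) \<le> (real i + 2) * real s"
      using i by (simp add: algebra_simps)
    then have "(real s + 1) * (real i + 1) * (x $ i)\<^sup>2 \<le> (real i + 2) * real s * (x $ i)\<^sup>2"
      by (rule mult_right_mono) simp
    also have "\<dots> \<le> real s * (2 * (real i + 1) * z $ i)"
      using mult_left_mono[OF *, of "real s"] by (simp add: mult_ac)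
    finally have "(real i + 1) * ((real s + 1) * (x $ i)\<^sup>2) \<le> (real i + 1) * (2 * real s * z $ i)"
      by (simp add: mult_ac)
    then show ?thesis
      by (rule mult_left_le_imp_le) simp
  qed
  have w_nonneg: "w $ i \<ge> 0" if "i < s" for i
    using assms(11)[folded L_def, folded K_def, folded w_def] that carrier_vecD[OF carr(5)]
    by (simp add: less_eq_vec_def)
  have w: "(\<Sum>i<s. w $ i * v $ i) = b \<bullet> (K *\<^sub>v v)" if "v \<in> carrier_vec s" for v
  proof -
    have "b \<bullet> (K *\<^sub>v v) = w \<bullet> v"
      unfolding w_def using that by (simp add: transpose_vec_mult_scalar[of _ s s])
    then show ?thesis using that by (simp add: scalar_prod_def lessThan_atLeast0)
  qed
  have wx: "(\<Sum>i<s. w $ i * x $ i) = 1"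
    using w[of x] assms(5) by (simp add: Kx e_def)
  \<comment> \<open>The second-order condition enters through w.z = b.Kz = b.x = b.e + r
    b.Ae.\<close>
  have "x = 1\<^sub>m s *\<^sub>v e + (r \<cdot>\<^sub>m A) *\<^sub>v e"
    unfolding x_def L_def by (rule add_mult_distrib_mat_vec) auto
  also have "(r \<cdot>\<^sub>m A) *\<^sub>v e = r \<cdot>\<^sub>v (A *\<^sub>v e)"
    by (intro eq_vecI)
      (auto simp: scalar_prod_def sum_distrib_left carrier_vecD[OF carr(2)] intro!: sum.cong)
  finally have "x = e + r \<cdot>\<^sub>v (A *\<^sub>v e)"
    by simp
  moreover have "A *\<^sub>v e \<in> carrier_vec s"
    by (rule mult_mat_vec_carrier[OF assms(2) carr(2)])
  ultimately have "b \<bullet> x = b \<bullet> e + r * (b \<bullet> (A *\<^sub>v e))"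
    by (simp add: scalar_prod_add_distrib[of _ s] scalar_prod_smult_distrib[of _ s])
  then have "b \<bullet> x = 1 + r / 2"
    using assms(5,6) by (simp flip: e_def)
  then have wz: "(\<Sum>i<s. w $ i * z $ i) = 1 + r / 2"
    using w[of z] by (simp add: Kz)
  have "r * (\<Sum>i<s. w $ i * e $ i) \<le> 1"
    using w[of e] assms(12)[folded L_def, folded K_def, folded e_def] by simp
  then have we: "r * (\<Sum>i<s. w $ i) \<le> 1"
    by (simp add: e_nth)
  define Q where "Q = (\<Sum>i<s. w $ i * (x $ i)\<^sup>2)"
  have "0 \<le> Q"
    unfolding Q_def using w_nonneg by (intro sum_nonneg) simp
  \<comment> \<open>Cauchy-Schwarz is applied to w.x = 1. Multiplying by \<open>r\<close> and using
    that the initial mass is at most 1 gives r \<le> Q.\<close>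
  have "1 \<le> (\<Sum>i<s. w $ i) * Q"
    using weighted_Cauchy_Schwarz[of "{..<s}" "\<lambda>i. w $ i" "\<lambda>i. x $ i"] w_nonneg
    by (simp add: wx Q_def)
  then have "r \<le> r * (\<Sum>i<s. w $ i) * Q"
    using assms(7) by (simp add: mult.assoc)
  also have "\<dots> \<le> Q"
    using mult_right_mono[OF we \<open>0 \<le> Q\<close>] by simp
  \<comment> \<open>Averaging \<open>moments\<close> over \<open>w\<close> gives (s + 1) r \<le> 2s
    + s r, where s r cancels.\<close>
  finally have "(real s + 1) * r \<le> (real s + 1) * Q"
    by (intro mult_left_mono) auto
  also have "\<dots> = (\<Sum>i<s. w $ i * ((real s + 1) * (x $ i)\<^sup>2))"
    by (simp add: Q_def sum_distrib_left mult_ac)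
  also have "\<dots> \<le> (\<Sum>i<s. w $ i * (2 * real s * z $ i))"
    using w_nonneg moments by (intro sum_mono mult_left_mono) auto
  also have "\<dots> = 2 * real s * (1 + r / 2)"
    by (simp add: sum_distrib_left mult_ac flip: wz)
  finally show ?thesis by (simp add: algebra_simps)
qed

end
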